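(* Assume (OPT) is monotone with proxy function $m$. Let $\eta>0$ and let $0\le\delta^l\le\delta^u$ be a lower and an upper bound on the optimal value $\delta^*$ of (BLM), i.e. $\delta^l\le\delta^*\le\delta^u$. Then the binary search algorithm (Algorithm 1, described in the context) run on input $\langle\delta^l,\delta^u,\eta\rangle$ computes an $\eta$-approximation of (BL): it terminates, and every vector $d^u$ it may return satisfies $d^u\in\mathcal{F}^{BL}$ and $$\|d^u-\tilde d\|_2^2\le\|d^*-\tilde d\|_2^2+\eta$$ for every optimal solution $d^*$ of (BL).
   Context: Setting. $f:\mathbb{R}^n\to\mathbb{R}$ is an objective function and $g:\mathbb{R}^n\times\mathbb{R}^k\to\mathbb{R}^r$ is a constraint map (inequalities between vectors are componentwise). For $d\in\mathbb{R}^k$ let $\mathcal{F}(d)=\{x\in\mathbb{R}^n : g(x,d)\ge 0,\ x\ge 0\}$ and let $\mathcal{O}(d)=\min_{x\in\mathcal{F}(d)} f(x)$ be the optimal value of the parametric optimization problem (OPT). The minimum is understood to be attained whenever $\mathcal{F}(d)\neq\emptyset$; if $\mathcal{F}(d)=\emptyset$ then $d$ does not satisfy any constraint that bounds $\mathcal{O}(d)$ from above. Data. $d^o\in\mathbb{R}^k$ is the original (sensitive) vector, with $\mathcal{F}(d^o)\ne\emptyset$; $\tilde d\in\mathbb{R}^k$ is a given vector (a perturbed version of $d^o$); $\tilde f\in\mathbb{R}$ satisfies $|\mathcal{O}(d^o)-\tilde f|\le\beta^o$ for some $\beta^o>0$; and $\beta\ge\beta^o$ is a parameter. (BL) is the problem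 $\min_{d\in\mathbb{R}^k}\|d-\tilde d\|_2^2$ s.t. $|\mathcal{O}(d)-\tilde f|\le\beta$, with feasible set $\mathcal{F}^{BL}=\{d\in\mathbb{R}^k:|\mathcal{O}(d)-\tilde f|\le\beta\}$. Monotonicity. Let $\mathcal{N}=\{d\in\mathbb{R}^k : \exists x\ge 0,\ g(x,d)\ge 0 \text{ and } |f(x)-\tilde f|\le\beta\}$. (OPT) is monotone if there is a concave function $m:\mathbb{R}^k\to\mathbb{R}$ (the proxy function) such that for all $d^1,d^2\in\mathcal{N}$, $m(d^1)\ge m(d^2)$ implies $\mathcal{O}(d^1)\ge\mathcal{O}(d^2)$. Such an $m$ is fixed. For $\delta\ge0$, $\mathcal{O}^{\uparrow}(\delta)$ is the problem of maximizing $m(d)$ over pairs $(d,x)$ with $x\ge0$, $g(x,d)\ge0$, $|f(x)-\tilde f|\le\beta$ and $\|d-\tilde d\|_2^2\le\delta$. This maximum is understood to be attained whenever the feasible set is nonempty. $\mathcal{S}^{\uparrow}(\delta)$ is the set of optimal solutions $(d,x)$; the notation $d\in\mathcal{S}^{\uparrow}(\delta)$ means that $(d,x)\in\mathcal{S}^{\uparrow}(\delta)$ for some $x$. (BLM) is the problem $\min_{d\in\mathbb{R}^k,\,\delta\ge0}\ \delta$ s.t. $d\in\mathcal{S}^{\uparrow}(\delta)$ and $\mathcal{O}(d)\ge\tilde f-\beta$. The minima in (BL) and (BLM) are understood to be attained. Algorithm 1. Input $\langle\delta^l,\delta^u,\eta\rangle$. While $\delta^u-\delta^l>\eta$: set $\delta\leftarrow(\delta^l+\delta^u)/2$;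 solve $\mathcal{O}^{\uparrow}(\delta)$ and let $(d^{\uparrow},x^{\uparrow})$ be an (arbitrary) optimal solution; set $\delta^{\uparrow}\leftarrow\|d^{\uparrow}-\tilde d\|_2^2$; if $\mathcal{O}(d^{\uparrow})\ge\tilde f-\beta$ then set $\delta^u\leftarrow\delta^{\uparrow}$, else set $\delta^l\leftarrow\delta$ (the else branch is also taken if $\mathcal{O}^{\uparrow}(\delta)$ is infeasible). When the loop ends, return an (arbitrary) vector $d^u\in\mathcal{S}^{\uparrow}(\delta^u)$. Subproblems are assumed to be solved exactly. *)

theory Defs
  imports "HOL-Analysis.Analysis"
begin

text \<open>The order on \<open>real ^ 'n\<close> is the componentwise one, and its norm is the Euclidean norm.\<close>

definition feasible_opt :: "(real^'n \<Rightarrow> real^'k \<Rightarrow> real^'r) \<Rightarrow> real^'k \<Rightarrow> (real^'n) set" where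
  "feasible_opt g d = {x. g x d \<ge> 0 \<and> x \<ge> 0}"

text \<open>The value is extended real: it is \<open>\<infinity>\<close> if the problem is infeasible, so that an
  infeasible \<open>d\<close> violates every (finite) upper bound on the value.\<close>

definition opt_value ::
  "(real^'n \<Rightarrow> real) \<Rightarrow> (real^'n \<Rightarrow> real^'k \<Rightarrow> real^'r) \<Rightarrow> real^'k \<Rightarrow> ereal" where
  "opt_value f g d = (INF x\<in>feasible_opt g d. ereal (f x))"

definition BL_feasible ::
  "(real^'n \<Rightarrow> real) \<Rightarrow> (real^'n \<Rightarrow> real^'k \<Rightarrow> real^'r) \<Rightarrow> real \<Rightarrow> real \<Rightarrow> (real^'k) set" where
  "BL_feasible f g ft \<beta> = {d. \<bar>opt_value f g d - ereal ft\<bar> \<le> ereal \<beta>}"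

definition BL_optimal ::
  "(real^'n \<Rightarrow> real) \<Rightarrow> (real^'n \<Rightarrow> real^'k \<Rightarrow> real^'r) \<Rightarrow> real \<Rightarrow> real \<Rightarrow> real^'k
    \<Rightarrow> real^'k \<Rightarrow> bool" where
  "BL_optimal f g ft \<beta> dt d \<longleftrightarrow>
    is_arg_min (\<lambda>d. (norm (d - dt))\<^sup>2) (\<lambda>d. d \<in> BL_feasible f g ft \<beta>) d"

definition near_feasible ::
  "(real^'n \<Rightarrow> real) \<Rightarrow> (real^'n \<Rightarrow> real^'k \<Rightarrow> real^'r) \<Rightarrow> real \<Rightarrow> real \<Rightarrow> (real^'k) set" where
  "near_feasible f g ft \<beta> = {d. \<exists>x. x \<ge> 0 \<and> g x d \<ge> 0 \<and> \<bar>f x - ft\<bar> \<le> \<beta>}"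

definition monotone_proxy ::
  "(real^'n \<Rightarrow> real) \<Rightarrow> (real^'n \<Rightarrow> real^'k \<Rightarrow> real^'r) \<Rightarrow> real \<Rightarrow> real
    \<Rightarrow> (real^'k \<Rightarrow> real) \<Rightarrow> bool" where
  "monotone_proxy f g ft \<beta> m \<longleftrightarrow>
    concave_on UNIV m \<and>
    (\<forall>d1\<in>near_feasible f g ft \<beta>. \<forall>d2\<in>near_feasible f g ft \<beta>.
       m d1 \<ge> m d2 \<longrightarrow> opt_value f g d1 \<ge> opt_value f g d2)"

definition up_feasible ::
  "(real^'n \<Rightarrow> real) \<Rightarrow> (real^'n \<Rightarrow> real^'k \<Rightarrow> real^'r) \<Rightarrow> real \<Rightarrow> real \<Rightarrow> real^'k
    \<Rightarrow> real \<Rightarrow> ((real^'k) \<times> (real^'n)) set" where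
  "up_feasible f g ft \<beta> dt \<delta> =
    {(d, x). x \<ge> 0 \<and> g x d \<ge> 0 \<and> \<bar>f x - ft\<bar> \<le> \<beta> \<and> (norm (d - dt))\<^sup>2 \<le> \<delta>}"

definition up_solutions ::
  "(real^'n \<Rightarrow> real) \<Rightarrow> (real^'n \<Rightarrow> real^'k \<Rightarrow> real^'r) \<Rightarrow> real \<Rightarrow> real \<Rightarrow> real^'k
    \<Rightarrow> (real^'k \<Rightarrow> real) \<Rightarrow> real \<Rightarrow> ((real^'k) \<times> (real^'n)) set" where
  "up_solutions f g ft \<beta> dt m \<delta> =
    {p. is_arg_max (\<lambda>(d, x). m d) (\<lambda>p. p \<in> up_feasible f g ft \<beta> dt \<delta>) p}"

definition BLM_feasible ::
  "(real^'n \<Rightarrow> real) \<Rightarrow> (real^'n \<Rightarrow> real^'k \<Rightarrow> real^'r) \<Rightarrow> real \<Rightarrow> real \<Rightarrow> real^'k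
    \<Rightarrow> (real^'k \<Rightarrow> real) \<Rightarrow> ((real^'k) \<times> real) set" where
  "BLM_feasible f g ft \<beta> dt m =
    {(d, \<delta>). \<delta> \<ge> 0 \<and> (\<exists>x. (d, x) \<in> up_solutions f g ft \<beta> dt m \<delta>) \<and>
             opt_value f g d \<ge> ereal (ft - \<beta>)}"

definition BLM_optimal ::
  "(real^'n \<Rightarrow> real) \<Rightarrow> (real^'n \<Rightarrow> real^'k \<Rightarrow> real^'r) \<Rightarrow> real \<Rightarrow> real \<Rightarrow> real^'k
    \<Rightarrow> (real^'k \<Rightarrow> real) \<Rightarrow> (real^'k) \<times> real \<Rightarrow> bool" where
  "BLM_optimal f g ft \<beta> dt m p \<longleftrightarrow>
    is_arg_min (\<lambda>(d, \<delta>). \<delta>) (\<lambda>p. p \<in> BLM_feasible f g ft \<beta> dt m) p"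

text \<open>The binary search as a nondeterministic transition system: \<open>Loop l u\<close> is the head of the
  while loop with current bounds \<open>l\<close> and \<open>u\<close>, and \<open>Return d\<close> is the final state with output \<open>d\<close>.
  The nondeterminism is the choice of the optimal solutions of the subproblems.\<close>

datatype 'd search_state = Loop real real | Return 'd

inductive search_step ::
  "(real^'n \<Rightarrow> real) \<Rightarrow> (real^'n \<Rightarrow> real^'k \<Rightarrow> real^'r) \<Rightarrow> real \<Rightarrow> real \<Rightarrow> real^'k
    \<Rightarrow> (real^'k \<Rightarrow> real) \<Rightarrow> real \<Rightarrow> (real^'k) search_state \<Rightarrow> (real^'k) search_state \<Rightarrow> bool"
  for f g ft \<beta> dt m \<eta> where
  upper:
    "\<lbrakk>u - l > \<eta>; (d, x) \<in> up_solutions f g ft \<beta> dt m ((l + u) / 2);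
      opt_value f g d \<ge> ereal (ft - \<beta>)\<rbrakk>
     \<Longrightarrow> search_step f g ft \<beta> dt m \<eta> (Loop l u) (Loop l ((norm (d - dt))\<^sup>2))"
| lower:
    "\<lbrakk>u - l > \<eta>; (d, x) \<in> up_solutions f g ft \<beta> dt m ((l + u) / 2);
      \<not> opt_value f g d \<ge> ereal (ft - \<beta>)\<rbrakk>
     \<Longrightarrow> search_step f g ft \<beta> dt m \<eta> (Loop l u) (Loop ((l + u) / 2) u)"
| infeasible:
    "\<lbrakk>u - l > \<eta>; up_feasible f g ft \<beta> dt ((l + u) / 2) = {}\<rbrakk>
     \<Longrightarrow> search_step f g ft \<beta> dt m \<eta> (Loop l u) (Loop ((l + u) / 2) u)"
| return:
    "\<lbrakk>\<not> u - l > \<eta>; (d, x) \<in> up_solutions f g ft \<beta> dt m u\<rbrakk>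
     \<Longrightarrow> search_step f g ft \<beta> dt m \<eta> (Loop l u) (Return d)"

definition search_output ::
  "(real^'n \<Rightarrow> real) \<Rightarrow> (real^'n \<Rightarrow> real^'k \<Rightarrow> real^'r) \<Rightarrow> real \<Rightarrow> real \<Rightarrow> real^'k
    \<Rightarrow> (real^'k \<Rightarrow> real) \<Rightarrow> real \<Rightarrow> real \<Rightarrow> real \<Rightarrow> real^'k \<Rightarrow> bool" where
  "search_output f g ft \<beta> dt m \<delta>l \<delta>u \<eta> d \<longleftrightarrow>
    (search_step f g ft \<beta> dt m \<eta>)\<^sup>*\<^sup>* (Loop \<delta>l \<delta>u) (Return d)"

text \<open>Termination: there is no infinite run, and no run gets stuck before returning a vector.\<close>

definition search_terminates ::
  "(real^'n \<Rightarrow> real) \<Rightarrow> (real^'n \<Rightarrow> real^'k \<Rightarrow> real^'r) \<Rightarrow> real \<Rightarrow> real \<Rightarrow> real^'k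
    \<Rightarrow> (real^'k \<Rightarrow> real) \<Rightarrow> real \<Rightarrow> real \<Rightarrow> real \<Rightarrow> bool" where
  "search_terminates f g ft \<beta> dt m \<delta>l \<delta>u \<eta> \<longleftrightarrow>
    \<not> (\<exists>\<sigma>. \<sigma> 0 = Loop \<delta>l \<delta>u \<and> (\<forall>i::nat. search_step f g ft \<beta> dt m \<eta> (\<sigma> i) (\<sigma> (Suc i)))) \<and>
    (\<forall>s. (search_step f g ft \<beta> dt m \<eta>)\<^sup>*\<^sup>* (Loop \<delta>l \<delta>u) s \<longrightarrow>
         (\<exists>s'. search_step f g ft \<beta> dt m \<eta> s s') \<or> (\<exists>d. s = Return d))"

end

theory Submission imports Defs begin

text \<open>Call a radius \<open>\<delta>\<close> certified if \<open>d \<in> S\<up>(\<delta>)\<close> and \<open>O(d) \<ge> ft - \<beta>\<close> for some \<open>d\<close>. Enlarging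
  \<open>\<delta>\<close> can only raise the maximum of the proxy, so by monotonicity every solution at a radius above
  a certified one is again certified. Hence \<open>\<delta>s\<close>, the least certified radius, separates the
  outcomes of the test in the loop, and \<open>l \<le> \<delta>s \<le> u\<close> is invariant. A feasible point \<open>d\<close> of (BL)
  certifies the radius \<open>\<parallel>d - dt\<parallel>\<^sup>2\<close>, so \<open>\<delta>s\<close> is also a lower bound for (BL), while the points
  of \<open>S\<up>(u)\<close> are feasible for (BL) and within radius \<open>u \<le> l + \<eta> \<le> \<delta>s + \<eta>\<close>.\<close>

section \<open>Values and feasible sets of the problems involved\<close>

lemma opt_value_le:
  assumes "x \<ge> 0" "g x d \<ge> 0"
  shows "opt_value f g d \<le> ereal (f x)"
  unfolding opt_value_def feasible_opt_def using assms by (auto intro: INF_lower)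

lemma opt_value_eq:
  assumes "is_arg_min f (\<lambda>x. x \<in> feasible_opt g d) x"
  shows "opt_value f g d = ereal (f x)"
  unfolding opt_value_def using assms
  by (intro antisym INF_lower INF_greatest) (auto simp: is_arg_min_linorder)

lemma ereal_abs_diff_le_iff:
  "\<bar>v - ereal a\<bar> \<le> ereal b \<longleftrightarrow> ereal (a - b) \<le> v \<and> v \<le> ereal (a + b)"
  by (cases v) auto

lemma up_solutions_iff:
  "(d, x) \<in> up_solutions f g ft \<beta> dt m \<delta> \<longleftrightarrow>
    (d, x) \<in> up_feasible f g ft \<beta> dt \<delta> \<and>
    (\<forall>(d', x') \<in> up_feasible f g ft \<beta> dt \<delta>. m d' \<le> m d)"
  by (auto simp: up_solutions_def is_arg_max_linorder)

lemma up_feasible_mono: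
  "\<delta> \<le> \<delta>' \<Longrightarrow> up_feasible f g ft \<beta> dt \<delta> \<subseteq> up_feasible f g ft \<beta> dt \<delta>'"
  by (auto simp: up_feasible_def)

lemma up_feasible_imp_near_feasible:
  "(d, x) \<in> up_feasible f g ft \<beta> dt \<delta> \<Longrightarrow> d \<in> near_feasible f g ft \<beta>"
  by (auto simp: up_feasible_def near_feasible_def)

text \<open>A maximiser stays one on any smaller feasible set that still contains it. Hence the
  accepting branch may take the radius of \<open>d\<close> itself, instead of the midpoint, as the
  new upper bound.\<close>

lemma up_solutions_shrink_radius:
  assumes "(d, x) \<in> up_solutions f g ft \<beta> dt m \<delta>"
  shows "(d, x) \<in> up_solutions f g ft \<beta> dt m ((norm (d - dt))\<^sup>2)"
proof -
  have "(norm (d - dt))\<^sup>2 \<le> \<delta>"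
    using assms by (simp add: up_solutions_iff up_feasible_def)
  then have "up_feasible f g ft \<beta> dt ((norm (d - dt))\<^sup>2) \<subseteq> up_feasible f g ft \<beta> dt \<delta>"
    by (rule up_feasible_mono)
  then show ?thesis
    using assms unfolding up_solutions_iff by (auto simp: up_feasible_def)
qed

text \<open>Any witness \<open>x\<close> of near-feasibility already bounds the value from above by
  \<open>ft + \<beta>\<close>, so only the lower bound has to be tested.\<close>

lemma near_feasible_imp_BL_feasible:
  assumes "d \<in> near_feasible f g ft \<beta>" "opt_value f g d \<ge> ereal (ft - \<beta>)"
  shows "d \<in> BL_feasible f g ft \<beta>"
proof -
  obtain x where "x \<ge> 0" "g x d \<ge> 0" "\<bar>f x - ft\<bar> \<le> \<beta>"
    using assms(1) by (auto simp: near_feasible_def)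
  then have "opt_value f g d \<le> ereal (f x)" "ereal (f x) \<le> ereal (ft + \<beta>)"
    by (auto intro: opt_value_le)
  with assms(2) show ?thesis
    by (auto simp: BL_feasible_def ereal_abs_diff_le_iff intro: order_trans)
qed

text \<open>Attainment supplies the witness: at an exact minimiser \<open>x\<close>,
  \<open>f x\<close> equals the value and so lies within \<beta> of \<open>ft\<close>, which an
  arbitrary feasible \<open>x\<close> need not satisfy.\<close>

lemma BL_feasible_imp_up_feasible:
  assumes attained: "feasible_opt g d \<noteq> {} \<Longrightarrow> \<exists>x. is_arg_min f (\<lambda>x. x \<in> feasible_opt g d) x"
    and "d \<in> BL_feasible f g ft \<beta>"
  shows "\<exists>x. (d, x) \<in> up_feasible f g ft \<beta> dt ((norm (d - dt))\<^sup>2)"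
proof -
  have "opt_value f g d \<le> ereal (ft + \<beta>)" "opt_value f g d \<ge> ereal (ft - \<beta>)"
    using assms(2) by (auto simp: BL_feasible_def ereal_abs_diff_le_iff)
  \<comment> \<open>The infimum over the empty set is \<infinity>, which exceeds the finite upper
    bound.\<close>
  moreover from this have "feasible_opt g d \<noteq> {}"
    by (auto simp: opt_value_def top_ereal_def)
  then obtain x where "is_arg_min f (\<lambda>x. x \<in> feasible_opt g d) x"
    using attained by blast
  ultimately show ?thesis
    by (intro exI[of _ x])
      (auto simp: opt_value_eq up_feasible_def feasible_opt_def is_arg_min_def)
qed

section \<open>Certified radii and the optimal value of (BLM)\<close>

locale binary_search =
  fixes f :: "real^'n \<Rightarrow> real"
    and g :: "real^'n \<Rightarrow> real^'k \<Rightarrow> real^'r"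
    and dt :: "real^'k"
    and ft \<beta> \<eta> \<delta>s :: real
    and m :: "real^'k \<Rightarrow> real"
  assumes opt_attained:
      "\<And>d. feasible_opt g d \<noteq> {} \<Longrightarrow> \<exists>x. is_arg_min f (\<lambda>x. x \<in> feasible_opt g d) x"
    and mono: "monotone_proxy f g ft \<beta> m"
    and up_attained:
      "\<And>\<delta>. \<delta> \<ge> 0 \<Longrightarrow> up_feasible f g ft \<beta> dt \<delta> \<noteq> {} \<Longrightarrow> up_solutions f g ft \<beta> dt m \<delta> \<noteq> {}"
    and BLM_value: "\<exists>d. BLM_optimal f g ft \<beta> dt m (d, \<delta>s)"
    and \<eta>: "\<eta> > 0"
begin

abbreviation "feas \<equiv> up_feasible f g ft \<beta> dt"
abbreviation "sols \<equiv> up_solutions f g ft \<beta> dt m"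
abbreviation "val \<equiv> opt_value f g"
abbreviation "step \<equiv> search_step f g ft \<beta> dt m \<eta>"

text \<open>Both points are feasible at the larger radius, where \<open>d'\<close> maximises the
  proxy; monotonicity carries \<open>m d \<le> m d'\<close> over to the values.\<close>

lemma val_mono_radius:
  assumes "(d, x) \<in> feas \<delta>" "\<delta> \<le> \<delta>'" "(d', x') \<in> sols \<delta>'"
  shows "val d \<le> val d'"
proof -
  have "(d, x) \<in> feas \<delta>'" "(d', x') \<in> feas \<delta>'"
    using assms by (auto simp: up_solutions_iff intro: subsetD[OF up_feasible_mono])
  moreover from this have "m d \<le> m d'"
    using assms(3) by (auto simp: up_solutions_iff)
  ultimately show ?thesis
    using mono by (simp add: monotone_proxy_def up_feasible_imp_near_feasible)
qed

lemma value_le_certified: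
  assumes "(d, x) \<in> sols \<delta>" "val d \<ge> ereal (ft - \<beta>)" "\<delta> \<ge> 0"
  shows "\<delta>s \<le> \<delta>"
proof -
  have "(d, \<delta>) \<in> BLM_feasible f g ft \<beta> dt m"
    using assms by (auto simp: BLM_feasible_def)
  then show ?thesis
    using BLM_value by (auto simp: BLM_optimal_def is_arg_min_linorder)
qed

lemma value_certified:
  obtains d x where "(d, x) \<in> feas \<delta>s" "val d \<ge> ereal (ft - \<beta>)"
proof -
  obtain d where "(d, \<delta>s) \<in> BLM_feasible f g ft \<beta> dt m"
    using BLM_value by (auto simp: BLM_optimal_def is_arg_min_def)
  then show thesis
    using that by (auto simp: BLM_feasible_def up_solutions_iff)
qed

lemma feas_nonempty_above_value:
  assumes "\<delta>s \<le> \<delta>"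
  shows "feas \<delta> \<noteq> {}"
proof -
  obtain d x where "(d, x) \<in> feas \<delta>s"
    by (rule value_certified)
  then have "(d, x) \<in> feas \<delta>"
    by (rule subsetD[OF up_feasible_mono[OF assms]])
  then show ?thesis
    by auto
qed

text \<open>The comparison is with an optimal point of (BLM). Read contrapositively, a failed test
  at the midpoint places the midpoint below \<open>\<delta>s\<close>.\<close>

lemma val_ge_above_value:
  assumes "\<delta>s \<le> \<delta>" "(d, x) \<in> sols \<delta>"
  shows "val d \<ge> ereal (ft - \<beta>)"
proof -
  obtain d' x' where "(d', x') \<in> feas \<delta>s" "val d' \<ge> ereal (ft - \<beta>)"
    by (rule value_certified)
  with val_mono_radius[OF this(1) assms] show ?thesis
    by simp
qed

text \<open>The point \<open>d\<close> need not maximise the proxy within its own radius, so it may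
  be infeasible for (BLM). A maximiser \<open>d'\<close> at that radius has at least the value of
  \<open>d\<close> and certifies the radius in its place.\<close>

lemma value_le_BL_feasible:
  assumes "d \<in> BL_feasible f g ft \<beta>"
  shows "\<delta>s \<le> (norm (d - dt))\<^sup>2"
proof -
  let ?\<delta> = "(norm (d - dt))\<^sup>2"
  obtain x where x: "(d, x) \<in> feas ?\<delta>"
    using BL_feasible_imp_up_feasible[OF opt_attained assms] by blast
  then have "sols ?\<delta> \<noteq> {}"
    by (intro up_attained) auto
  then obtain d' x' where d': "(d', x') \<in> sols ?\<delta>"
    by auto
  have "ereal (ft - \<beta>) \<le> val d"
    using assms by (simp add: BL_feasible_def ereal_abs_diff_le_iff)
  also have "\<dots> \<le> val d'"
    using val_mono_radius[OF x _ d'] by simp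
  finally show ?thesis
    using value_le_certified[OF d'] by simp
qed

section \<open>Invariant of the search\<close>

fun search_inv :: "(real^'k) search_state \<Rightarrow> bool" where
  "search_inv (Loop l u) \<longleftrightarrow> 0 \<le> l \<and> l \<le> \<delta>s \<and> \<delta>s \<le> u"
| "search_inv (Return d) \<longleftrightarrow>
    d \<in> BL_feasible f g ft \<beta> \<and> (norm (d - dt))\<^sup>2 \<le> \<delta>s + \<eta>"

lemma search_inv_step:
  assumes "step s s'" "search_inv s"
  shows "search_inv s'"
  using assms
proof cases
  case (upper u l d x)
  then have "\<delta>s \<le> (norm (d - dt))\<^sup>2"
    using value_le_certified[OF up_solutions_shrink_radius] by simp
  then show ?thesis
    using upper assms(2) by simp
next
  case (lower u l d x)
  then have "(l + u) / 2 < \<delta>s"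
    using val_ge_above_value[of "(l + u) / 2" d x] by linarith
  then show ?thesis
    using lower assms(2) by simp
next
  case (infeasible u l)
  \<comment> \<open>An empty subproblem counts as a failed test: from radius
    \<open>\<delta>s\<close> on, an optimal point of (BLM) is available.\<close>
  then have "(l + u) / 2 < \<delta>s"
    using feas_nonempty_above_value[of "(l + u) / 2"] by linarith
  then show ?thesis
    using infeasible assms(2) by simp
next
  case (return u l d x)
  then have "val d \<ge> ereal (ft - \<beta>)" and feas: "(d, x) \<in> feas u"
    using assms(2) val_ge_above_value[of u d x] by (auto simp: up_solutions_iff)
  then have "d \<in> BL_feasible f g ft \<beta>"
    using near_feasible_imp_BL_feasible up_feasible_imp_near_feasible by blast
  then show ?thesis
    using return assms(2) feas by (simp add: up_feasible_def)
qed

lemma search_inv_reachable: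
  assumes "step\<^sup>*\<^sup>* s s'" "search_inv s"
  shows "search_inv s'"
  using assms by (induction rule: rtranclp_induct) (auto intro: search_inv_step)

section \<open>Progress and termination\<close>

lemma search_progress:
  assumes "search_inv (Loop l u)"
  shows "\<exists>s'. step (Loop l u) s'"
proof (cases "u - l > \<eta>")
  case True
  show ?thesis
  proof (cases "feas ((l + u) / 2) = {}")
    case True
    with \<open>u - l > \<eta>\<close> show ?thesis
      by (blast intro: search_step.infeasible)
  next
    case False
    \<comment> \<open>The invariant makes the midpoint nonnegative, as attainment requires.\<close>
    then obtain d x where "(d, x) \<in> sols ((l + u) / 2)"
      using up_attained[of "(l + u) / 2"] assms by fastforce
    with \<open>u - l > \<eta>\<close> show ?thesis
      by (blast intro: search_step.upper search_step.lower)
  qed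
next
  case False
  \<comment> \<open>Since \<open>\<delta>s \<le> u\<close>, the last subproblem is feasible, so
    there is a vector to return.\<close>
  obtain d x where "(d, x) \<in> sols u"
    using up_attained[of u] feas_nonempty_above_value[of u] assms by fastforce
  with False show ?thesis
    by (blast intro: search_step.return)
qed

text \<open>In the accepting branch the new upper bound is the radius of a point feasible at the
  midpoint, hence at most the midpoint; in the other branches the lower bound moves up to it. Either
  way the gap at least halves.\<close>

lemma step_Loop_Loop:
  assumes "step (Loop l u) (Loop l' u')"
  shows "u - l > \<eta>" "u' - l' \<le> (u - l) / 2"
proof -
  have "u - l > \<eta> \<and> u' - l' \<le> (u - l) / 2"
    using assms
  proof cases
    case (upper d x)
    then have "u' \<le> (l + u) / 2"
      by (simp add: up_solutions_iff up_feasible_def)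
    with upper show ?thesis
      by (simp add: field_simps)
  qed (simp_all add: field_simps)
  then show "u - l > \<eta>" "u' - l' \<le> (u - l) / 2"
    by simp_all
qed

lemma step_imp_Loop:
  assumes "step s s'"
  shows "\<exists>l u. s = Loop l u"
  using assms by cases auto

text \<open>The gaps are dominated by a geometric sequence tending to 0, yet each of them exceeds
  \<eta>.\<close>

lemma no_infinite_search:
  assumes run: "\<And>i. step (\<sigma> i) (\<sigma> (Suc i))"
  shows False
proof -
  \<comment> \<open>A \<open>Return\<close> state has no successor, so an infinite run visits
    \<open>Loop\<close> states only.\<close>
  obtain l u where \<sigma>: "\<And>i. \<sigma> i = Loop (l i) (u i)"
    using step_imp_Loop[OF run] by metis
  then have gap: "u i - l i > \<eta>" "u (Suc i) - l (Suc i) \<le> (u i - l i) / 2" for i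
    using step_Loop_Loop run[of i] by simp_all
  have bound: "u i - l i \<le> (u 0 - l 0) * (1 / 2) ^ i" for i
  proof (induction i)
    case (Suc i)
    then show ?case
      using gap(2)[of i] by simp
  qed simp
  have "(\<lambda>i. (u 0 - l 0) * (1 / 2) ^ i) \<longlonglongrightarrow> 0"
    by (intro tendsto_mult_right_zero LIMSEQ_power_zero) simp
  then have "\<eta> \<le> 0"
    by (rule LIMSEQ_le_const) (meson gap(1) bound less_imp_le order_trans)
  then show False
    using \<eta> by simp
qed

lemma search_terminates:
  assumes "search_inv (Loop \<delta>l \<delta>u)"
  shows "search_terminates f g ft \<beta> dt m \<delta>l \<delta>u \<eta>"
  unfolding search_terminates_def
proof (intro conjI allI impI)
  show "\<nexists>\<sigma>. \<sigma> 0 = Loop \<delta>l \<delta>u \<and> (\<forall>i. step (\<sigma> i) (\<sigma> (Suc i)))"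
    using no_infinite_search by blast
next
  fix s assume "step\<^sup>*\<^sup>* (Loop \<delta>l \<delta>u) s"
  then have "search_inv s"
    using assms by (rule search_inv_reachable)
  then show "(\<exists>s'. step s s') \<or> (\<exists>d. s = Return d)"
    using search_progress by (cases s) auto
qed

end

theorem theorem4:
  fixes f :: "real^'n \<Rightarrow> real"
    and g :: "real^'n \<Rightarrow> real^'k \<Rightarrow> real^'r"
    and d0 dt :: "real^'k"
    and ft \<beta>o \<beta> \<eta> \<delta>l \<delta>u \<delta>s :: real
    and m :: "real^'k \<Rightarrow> real"
  assumes opt_attained:
      "\<And>d. feasible_opt g d \<noteq> {} \<Longrightarrow> \<exists>x. is_arg_min f (\<lambda>x. x \<in> feasible_opt g d) x"
    and d0_feasible: "feasible_opt g d0 \<noteq> {}"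
    and ft: "\<bar>opt_value f g d0 - ereal ft\<bar> \<le> ereal \<beta>o"
    and \<beta>o: "\<beta>o > 0"
    and \<beta>: "\<beta> \<ge> \<beta>o"
    and mono: "monotone_proxy f g ft \<beta> m"
    and up_attained:
      "\<And>\<delta>. \<delta> \<ge> 0 \<Longrightarrow> up_feasible f g ft \<beta> dt \<delta> \<noteq> {} \<Longrightarrow> up_solutions f g ft \<beta> dt m \<delta> \<noteq> {}"
    and BL_attained: "\<exists>d. BL_optimal f g ft \<beta> dt d"
    and BLM_value: "\<exists>d. BLM_optimal f g ft \<beta> dt m (d, \<delta>s)"
    and \<eta>: "\<eta> > 0"
    and bounds: "0 \<le> \<delta>l" "\<delta>l \<le> \<delta>u" "\<delta>l \<le> \<delta>s" "\<delta>s \<le> \<delta>u"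
  shows "search_terminates f g ft \<beta> dt m \<delta>l \<delta>u \<eta> \<and>
    (\<forall>du. search_output f g ft \<beta> dt m \<delta>l \<delta>u \<eta> du \<longrightarrow>
      du \<in> BL_feasible f g ft \<beta> \<and>
      (\<forall>ds. BL_optimal f g ft \<beta> dt ds \<longrightarrow>
        (norm (du - dt))\<^sup>2 \<le> (norm (ds - dt))\<^sup>2 + \<eta>))"
proof -
  interpret binary_search f g dt ft \<beta> \<eta> \<delta>s m
    using opt_attained mono up_attained BLM_value \<eta> by unfold_locales
  have init: "search_inv (Loop \<delta>l \<delta>u)"
    using bounds by simp
  have "du \<in> BL_feasible f g ft \<beta> \<and> (norm (du - dt))\<^sup>2 \<le> \<delta>s + \<eta>"
    if "search_output f g ft \<beta> dt m \<delta>l \<delta>u \<eta> du" for du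
    using search_inv_reachable[OF that[unfolded search_output_def] init] by simp
  \<comment> \<open>The value \<open>\<delta>s\<close> links the two problems: the output is within
    \<eta> above it, and every feasible point of (BL) has at least this radius.\<close>
  moreover have "\<delta>s \<le> (norm (ds - dt))\<^sup>2" if "BL_optimal f g ft \<beta> dt ds" for ds
    using that value_le_BL_feasible by (simp add: BL_optimal_def is_arg_min_def)
  ultimately show ?thesis
    using search_terminates[OF init] by fastforce
qed

end
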